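(* Let $w(x_1,x_2)=x_1^{4/3}-x_2^{4/3}$ on $\mathbb R^2$. The function $v=\frac12|Dw|^2$ is a weak solution of the equation $$-\operatorname{div}\left(\frac{Dv}{|Dv|}\right)=\frac{|Dv|}{2v}-2\left(\mathcal H^1|_{\{x_1=0\}}+\mathcal H^1|_{\{x_2=0\}}\right)\quad\text{in }\mathbb R^2,$$ that is, for every $\phi\in C_c^\infty(\mathbb R^2)$, $$\int_{\mathbb R^2}\Big(\Big\langle\frac{Dv}{|Dv|},D\phi\Big\rangle-\frac{|Dv|}{2v}\phi\Big)\,dx=-2\int_{\mathbb R}\phi(x_1,0)\,dx_1-2\int_{\mathbb R}\phi(0,x_2)\,dx_2.$$
   Context: For real $t$, $t^{4/3}$ is understood as $|t|^{4/3}$ (and $t^{2/3}$ as $|t|^{2/3}$). $\mathcal H^1|_A$ is the one-dimensional Hausdorff measure restricted to $A$. $Dv$ is defined almost everywhere. *)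

theory Defs
  imports "HOL-Analysis.Analysis"
begin

text \<open>The plane is \<open>real \<times> real\<close>, whose library norm and inner product are the Euclidean ones.\<close>

text \<open>\<open>gradient f x\<close> is meaningful only where \<open>f\<close> is (Frechet) differentiable;
  elsewhere it is an unspecified vector.\<close>

definition gradient :: "('a::real_inner \<Rightarrow> real) \<Rightarrow> 'a \<Rightarrow> 'a" where
  "gradient f x = (THE d. GDERIV f x :> d)"

lemma gradient_eqI:
  assumes "GDERIV f x :> d"
  shows "gradient f x = d"
  unfolding gradient_def
proof (rule the_equality)
  show "GDERIV f x :> d" by (rule assms)
next
  fix e assume "GDERIV f x :> e"
  with assms have "(\<lambda>h. inner h d) = (\<lambda>h. inner h e)"
    unfolding gderiv_def by (rule has_derivative_unique)
  then have "inner (d - e) d = inner (d - e) e" by (rule fun_cong)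
  then have "inner (d - e) (d - e) = 0" by (simp only: inner_diff_right)
  then show "e = d" by simp
qed

text \<open>\<open>C_k k f\<close>: all iterated partial derivatives of \<open>f\<close> of order at most \<open>k\<close> exist and are
  continuous. (Requiring differentiability instead of mere existence of the partials is no
  restriction, as continuity of the partials implies it.)\<close>

primrec C_k :: "nat \<Rightarrow> ('a::euclidean_space \<Rightarrow> real) \<Rightarrow> bool" where
  "C_k 0 f \<longleftrightarrow> continuous_on UNIV f"
| "C_k (Suc k) f \<longleftrightarrow>
     (\<forall>x. f differentiable (at x)) \<and>
     (\<forall>i\<in>Basis. C_k k (\<lambda>x. frechet_derivative f (at x) i))"

definition test_function :: "('a::euclidean_space \<Rightarrow> real) \<Rightarrow> bool" where
  "test_function \<phi> \<longleftrightarrow> (\<forall>k. C_k k \<phi>) \<and> compact (closure {x. \<phi> x \<noteq> 0})"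

end

theory Submission
  imports Defs
begin

text \<open>
  Write \<open>c t = \<bar>t\<bar> powr (1/3)\<close>. Since \<open>Dw = 4/3 (sgn x c(x), - sgn y c(y))\<close>, one has
  \<open>v = 8/9 (c(x)\<^sup>2 + c(y)\<^sup>2)\<close>, and off the coordinate axes
  \<open>Dv = 16/27 (sgn x / c(x), sgn y / c(y))\<close>. Clearing denominators gives
  \<open>Dv / |Dv| = (sgn x c(y) / r, sgn y c(x) / r)\<close> with \<open>r = sqrt (c(x)\<^sup>2 + c(y)\<^sup>2)\<close>, and
  \<open>|Dv| / (2 v) = 1 / (3 c(x) c(y) r)\<close>. On each open quadrant the field \<open>Dv / |Dv|\<close> is smooth with
  divergence \<open>- |Dv| / (2 v)\<close>, and across each axis its normal component jumps from \<open>-1\<close> to \<open>1\<close>;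
  the jump of size 2 is the singular measure in the equation.

  The two components exchange roles under the reflection in the diagonal, so the proof is the study of
  one of them. With \<open>flux s t = c(s) / sqrt (c(s)\<^sup>2 + c(t)\<^sup>2)\<close> and
  \<open>flux_decay s t\<close> the rate at which the flux falls as \<open>t\<close> moves away from 0, the second component is
  \<open>sgn y flux x y\<close>, the first is \<open>sgn x flux y x\<close>, and \<open>|Dv| / (2 v)\<close> splits as
  \<open>flux_decay x y + flux_decay y x\<close>. On a line of fixed \<open>s \<noteq> 0\<close> the claim is the fundamental theorem of
  calculus with the jump at 0 taken into account (\<open>has_integral_sgn_flux_by_parts\<close>). Taking the
  constant function 1 there shows that \<open>flux_decay s\<close> has mass at most 2 on every such line, however
  small \<open>s\<close> is; hence the singular source is integrable on squares
  (\<open>integrable_flux_decay_square\<close>), Fubini's theorem applies, and integrating over \<open>s\<close> yields the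
  weak derivative in the plane (\<open>weak_derivative_sgn_flux\<close>). Adding the instance for \<open>\<phi>\<close> and the
  instance for the reflected \<open>\<phi>\<close> gives the theorem.
\<close>

section \<open>The absolute cube root and separable gradients\<close>

definition acbrt :: "real \<Rightarrow> real" where
  "acbrt t = \<bar>t\<bar> powr (1/3)"

lemma acbrt_zero [simp]: "acbrt 0 = 0"
  and acbrt_nonneg [simp]: "0 \<le> acbrt t"
  and acbrt_minus [simp]: "acbrt (- t) = acbrt t"
  by (simp_all add: acbrt_def)

lemma acbrt_pos [simp]: "0 < acbrt t \<longleftrightarrow> t \<noteq> 0"
  by (simp add: acbrt_def)

lemma acbrt_eq_0 [simp]: "acbrt t = 0 \<longleftrightarrow> t = 0"
  by (simp add: acbrt_def)

lemma continuous_on_acbrt: "continuous_on S acbrt"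
  unfolding acbrt_def by (intro continuous_on_powr' continuous_intros) auto

lemma borel_measurable_acbrt [measurable]: "acbrt \<in> borel_measurable borel"
  using continuous_on_acbrt by (rule borel_measurable_continuous_onI)

lemma abs_powr_four_thirds: "\<bar>t\<bar> powr (4/3) = \<bar>t\<bar> * acbrt t"
proof (cases "t = 0")
  case False
  have "\<bar>t\<bar> powr (1 + 1/3) = \<bar>t\<bar> powr 1 * \<bar>t\<bar> powr (1/3)" by (rule powr_add)
  then show ?thesis by (simp add: acbrt_def)
qed simp

lemma DERIV_abs_nonzero:
  fixes t :: real
  assumes "t \<noteq> 0"
  shows "DERIV abs t :> sgn t"
  using GDERIV_norm[OF assms] by (simp add: real_norm_def[abs_def])

lemma DERIV_acbrt:
  assumes "t \<noteq> 0"
  shows "DERIV acbrt t :> sgn t / (3 * (acbrt t)\<^sup>2)"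
proof -
  have "\<bar>t\<bar> powr (1/3 + 2/3) = \<bar>t\<bar> powr (1/3) * \<bar>t\<bar> powr (2/3)" by (rule powr_add)
  moreover have "(acbrt t)\<^sup>2 = \<bar>t\<bar> powr (2/3)"
    by (simp add: acbrt_def power2_eq_square flip: powr_add)
  ultimately have *: "\<bar>t\<bar> = acbrt t * (acbrt t)\<^sup>2" by (simp add: acbrt_def)
  have "((\<lambda>t. \<bar>t\<bar> powr (1/3)) has_real_derivative
      \<bar>t\<bar> powr (1/3) * (0 * ln \<bar>t\<bar> + sgn t * (1/3) / \<bar>t\<bar>)) (at t)"
    using assms by (intro has_real_derivative_powr' DERIV_abs_nonzero DERIV_const) auto
  moreover have "\<bar>t\<bar> powr (1/3) * (0 * ln \<bar>t\<bar> + sgn t * (1/3) / \<bar>t\<bar>) = sgn t / (3 * (acbrt t)\<^sup>2)"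
    unfolding acbrt_def[symmetric] unfolding * using assms by (simp add: field_simps)
  ultimately show ?thesis by (simp add: acbrt_def[abs_def])
qed

text \<open>The exponent exceeds 1, so differentiability survives at the origin: there the difference
  quotient is \<open>sgn h * acbrt h\<close>, which tends to 0.\<close>

lemma DERIV_abs_powr_four_thirds:
  "DERIV (\<lambda>t. \<bar>t\<bar> powr (4/3)) t :> 4/3 * sgn t * acbrt t"
proof (cases "t = 0")
  case True
  have "acbrt \<midarrow>0\<rightarrow> acbrt 0"
    using continuous_on_acbrt[of UNIV] unfolding continuous_on_def by blast
  then have "(\<lambda>h. sgn h * acbrt h) \<midarrow>0\<rightarrow> 0"
    by (intro tendsto_rabs_zero_cancel[of "\<lambda>h. sgn h * acbrt h"])
       (auto elim!: Lim_transform_eventually simp: eventually_at_filter abs_mult sgn_if)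
  moreover have "(\<bar>0 + h\<bar> * acbrt (0 + h) - \<bar>0\<bar> * acbrt 0) / h = sgn h * acbrt h" if "h \<noteq> 0" for h
    using that by (auto simp: sgn_if)
  ultimately have "(\<lambda>h. (\<bar>0 + h\<bar> * acbrt (0 + h) - \<bar>0\<bar> * acbrt 0) / h) \<midarrow>0\<rightarrow> 0"
    by (subst LIM_equal[where g="\<lambda>h. sgn h * acbrt h"]) auto
  then show ?thesis
    unfolding True abs_powr_four_thirds DERIV_def by simp
next
  case False
  have "((\<lambda>t. \<bar>t\<bar> powr (4/3)) has_real_derivative
      \<bar>t\<bar> powr (4/3) * (0 * ln \<bar>t\<bar> + sgn t * (4/3) / \<bar>t\<bar>)) (at t)"
    using False by (intro has_real_derivative_powr' DERIV_abs_nonzero DERIV_const) auto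
  then show ?thesis using False by (simp add: abs_powr_four_thirds mult_ac)
qed

lemma GDERIV_separable_sum:
  assumes "DERIV f x :> a" and "DERIV g y :> b"
  shows "GDERIV (\<lambda>p. f (fst p) + g (snd p)) (x, y) :> (a, b)"
proof -
  have "((\<lambda>p. f (fst p)) has_derivative (\<lambda>h. a * fst h)) (at (x, y))"
    using has_derivative_compose[OF has_derivative_fst[OF has_derivative_ident], of f "(*) a" "(x, y)" UNIV]
      assms(1) by (simp add: has_field_derivative_def)
  moreover have "((\<lambda>p. g (snd p)) has_derivative (\<lambda>h. b * snd h)) (at (x, y))"
    using has_derivative_compose[OF has_derivative_snd[OF has_derivative_ident], of g "(*) b" "(x, y)" UNIV]
      assms(2) by (simp add: has_field_derivative_def)
  ultimately have "((\<lambda>p. f (fst p) + g (snd p)) has_derivative (\<lambda>h. a * fst h + b * snd h)) (at (x, y))"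
    by (rule has_derivative_add)
  then show ?thesis by (simp add: gderiv_def inner_prod_def mult.commute)
qed

section \<open>The flux across an axis, line by line\<close>

text \<open>The modulus of the component of \<open>Dv / |Dv|\<close> normal to the axis \<open>t = 0\<close>, at distance \<open>\<bar>t\<bar>\<close>
  from that axis and \<open>\<bar>s\<bar>\<close> from the other one; the component itself has the sign of \<open>t\<close>.\<close>

definition flux :: "real \<Rightarrow> real \<Rightarrow> real" where
  "flux s t = acbrt s / sqrt ((acbrt s)\<^sup>2 + (acbrt t)\<^sup>2)"

text \<open>Minus the derivative of \<open>flux s\<close> in \<open>\<bar>t\<bar>\<close>, as \<open>DERIV_flux\<close> shows. For \<open>s \<noteq> 0\<close> it is infinite of order
  \<open>\<bar>t\<bar> powr (-1/3)\<close> at the axis; the totalised value there is 0.\<close>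

definition flux_decay :: "real \<Rightarrow> real \<Rightarrow> real" where
  "flux_decay s t = acbrt s / (3 * acbrt t * sqrt ((acbrt s)\<^sup>2 + (acbrt t)\<^sup>2) ^ 3)"

lemma flux_nonneg: "0 \<le> flux s t" and flux_decay_nonneg: "0 \<le> flux_decay s t"
  by (simp_all add: flux_def flux_decay_def)

lemma flux_le_1: "flux s t \<le> 1"
  unfolding flux_def by (intro divide_le_eq_1[THEN iffD2])
    (auto simp: real_le_rsqrt sum_power2_gt_zero_iff)

lemma flux_zero: "s \<noteq> 0 \<Longrightarrow> flux s 0 = 1"
  by (simp add: flux_def)

lemma continuous_on_flux: "s \<noteq> 0 \<Longrightarrow> continuous_on S (flux s)"
  unfolding flux_def
  by (intro continuous_intros continuous_on_subset[OF continuous_on_acbrt])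
     (auto simp: add_nonneg_eq_0_iff)

lemma borel_measurable_flux [measurable]:
  "(\<lambda>p. flux (f p) (g p)) \<in> borel_measurable M"
  if [measurable]: "f \<in> borel_measurable M" "g \<in> borel_measurable M"
  unfolding flux_def by measurable

lemma borel_measurable_flux_decay [measurable]:
  "(\<lambda>p. flux_decay (f p) (g p)) \<in> borel_measurable M"
  if [measurable]: "f \<in> borel_measurable M" "g \<in> borel_measurable M"
  unfolding flux_decay_def by measurable

lemma DERIV_flux:
  assumes "s \<noteq> 0" "t \<noteq> 0"
  shows "DERIV (flux s) t :> - sgn t * flux_decay s t"
proof -
  define r where "r = sqrt ((acbrt s)\<^sup>2 + (acbrt t)\<^sup>2)"
  have pos: "0 < (acbrt s)\<^sup>2 + (acbrt t)\<^sup>2" using assms by (simp add: sum_power2_gt_zero_iff)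
  then have r: "0 < r" by (simp add: r_def)
  have "DERIV (\<lambda>u. (acbrt s)\<^sup>2 + (acbrt u)\<^sup>2) t :> 2 * acbrt t * (sgn t / (3 * (acbrt t)\<^sup>2))"
    using assms by (auto intro!: derivative_eq_intros DERIV_acbrt)
  from DERIV_chain2[OF DERIV_real_sqrt[OF pos] this]
  have "DERIV (\<lambda>u. sqrt ((acbrt s)\<^sup>2 + (acbrt u)\<^sup>2)) t :>
      inverse r / 2 * (2 * acbrt t * (sgn t / (3 * (acbrt t)\<^sup>2)))"
    by (simp add: r_def)
  from DERIV_divide[OF DERIV_const[of "acbrt s"] this]
  have "DERIV (flux s) t :>
      (0 * r - acbrt s * (inverse r / 2 * (2 * acbrt t * (sgn t / (3 * (acbrt t)\<^sup>2))))) / (r * r)"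
    using r assms unfolding flux_def[abs_def] by (simp add: r_def)
  moreover have "(0 * r - acbrt s * (inverse r / 2 * (2 * acbrt t * (sgn t / (3 * (acbrt t)\<^sup>2))))) / (r * r)
      = - sgn t * flux_decay s t"
    unfolding flux_decay_def r_def[symmetric]
    using r assms by (simp add: field_simps power2_eq_square power3_eq_cube)
  ultimately show ?thesis by simp
qed

text \<open>Integration by parts for the odd field \<open>sgn t * flux s t\<close>. The function \<open>sgn t * flux s t * f t\<close>
  jumps by \<open>2 * f 0\<close> at 0. Subtracting \<open>sgn t * f 0\<close> removes the jump without changing the
  derivative elsewhere, and the continuous function so obtained is an antiderivative up to the single
  point 0, near which \<open>flux_decay s\<close> is unbounded.\<close>

lemma has_integral_sgn_flux_by_parts:
  fixes f g :: "real \<Rightarrow> real"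
  assumes s: "s \<noteq> 0" and M: "0 \<le> M"
    and f: "\<And>t. DERIV f t :> g t"
  shows "((\<lambda>t. sgn t * flux s t * g t - flux_decay s t * f t) has_integral
      (flux s M * f M - f 0) + (flux s M * f (- M) - f 0)) {- M..M}"
proof (cases "M = 0")
  case True
  then show ?thesis using s by (simp add: flux_zero has_integral_refl)
next
  case False
  define G where "G t = sgn t * (flux s t * f t - f 0)" for t
  have contf: "continuous_on UNIV f"
    using f by (meson DERIV_isCont continuous_at_imp_continuous_on)
  have dG: "DERIV G t :> sgn t * flux s t * g t - flux_decay s t * f t" if "t \<noteq> 0" for t
  proof -
    have "DERIV (\<lambda>u. sgn t * (flux s u * f u - f 0)) t :>
        sgn t * (- sgn t * flux_decay s t * f t + g t * flux s t)"
      using DERIV_cmult[OF DERIV_diff[OF DERIV_mult[OF DERIV_flux[OF s that] f[of t]] DERIV_const]]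
      by simp
    moreover have "sgn t * (- sgn t * flux_decay s t * f t + g t * flux s t)
        = sgn t * flux s t * g t - flux_decay s t * f t"
      using that by (simp add: sgn_if algebra_simps)
    moreover have "\<forall>\<^sub>F u in nhds t. sgn u = sgn t"
    proof (cases "t > 0")
      case True
      then have "\<forall>\<^sub>F u in nhds t. u \<in> {0<..}" by (intro eventually_nhds_in_open) auto
      then show ?thesis by (rule eventually_mono) (use True in simp)
    next
      case False
      then have "\<forall>\<^sub>F u in nhds t. u \<in> {..<0}" using that by (intro eventually_nhds_in_open) auto
      then show ?thesis by (rule eventually_mono) (use False that in simp)
    qed
    then have "\<forall>\<^sub>F u in nhds t. G u = sgn t * (flux s u * f u - f 0)"
      by eventually_elim (simp add: G_def)
    ultimately show ?thesis using DERIV_cong_ev[OF refl _ refl] by metis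
  qed
  have cG: "isCont G t" for t
  proof (cases "t = 0")
    case True
    have "continuous_on UNIV (\<lambda>t. flux s t * f t - f 0)"
      by (intro continuous_intros continuous_on_flux s contf)
    then have "(\<lambda>t. flux s t * f t - f 0) \<midarrow>0\<rightarrow> 0"
      using flux_zero[OF s] by (auto simp: continuous_on_def dest: spec[of _ 0])
    then have "(\<lambda>t. \<bar>flux s t * f t - f 0\<bar>) \<midarrow>0\<rightarrow> 0" by (rule tendsto_rabs_zero)
    then have "G \<midarrow>0\<rightarrow> 0"
      by (rule Lim_null_comparison[rotated]) (auto simp: G_def abs_mult sgn_if)
    then show ?thesis using True by (simp add: isCont_def G_def)
  qed (use dG DERIV_isCont in blast)
  have "((\<lambda>t. sgn t * flux s t * g t - flux_decay s t * f t) has_integral (G M - G (- M))) {- M..M}"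
    using M dG cG
    by (intro fundamental_theorem_of_calculus_strong[of "{0}"])
       (auto simp: has_real_derivative_iff_has_vector_derivative[symmetric]
          intro: continuous_at_imp_continuous_on)
  then show ?thesis using M False by (simp add: G_def flux_def)
qed

section \<open>From lines to the plane\<close>

text \<open>Integration by parts against the constant 1 evaluates the integral of \<open>flux_decay s\<close> over
  \<open>{- M..M}\<close> as \<open>2 - 2 * flux s M\<close>. The bound 2 is uniform in \<open>s\<close>, although \<open>flux_decay\<close> is unbounded
  near the axis.\<close>

lemma integrable_flux_decay_square:
  assumes M: "0 \<le> M"
  shows "integrable (lborel \<Otimes>\<^sub>M lborel)
    (\<lambda>(s, t). indicator {- M..M} s * (indicator {- M..M} t * flux_decay s t))"
proof (rule integrableI_nonneg)
  show "AE p in lborel \<Otimes>\<^sub>M lborel. 0 \<le> (case p of (s, t) \<Rightarrow>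
      indicator {- M..M} s * (indicator {- M..M} t * flux_decay s t))"
    by (auto simp: flux_decay_nonneg)
  have inner: "(\<integral>\<^sup>+t. ennreal (indicator {- M..M} t * flux_decay s t) \<partial>lborel) \<le> 2" for s
  proof (cases "s = 0")
    case True
    \<comment> \<open>On the other axis the flux is totalised to 0 and does not decay at all.\<close>
    then show ?thesis by (simp add: flux_decay_def)
  next
    case False
    have "((\<lambda>t. - flux_decay s t) has_integral (flux s M - 1) + (flux s M - 1)) {- M..M}"
      using has_integral_sgn_flux_by_parts[OF False M, of "\<lambda>_. 1" "\<lambda>_. 0"] by simp
    from has_integral_neg[OF this]
    have "(flux_decay s has_integral 2 - 2 * flux s M) {- M..M}" by (simp add: algebra_simps)
    from nn_integral_has_integral_lebesgue[OF flux_decay_nonneg this]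
    have "(\<integral>\<^sup>+t. ennreal (indicator {- M..M} t * flux_decay s t) \<partial>lborel) = ennreal (2 - 2 * flux s M)"
      by simp
    also have "\<dots> \<le> ennreal 2" by (rule ennreal_leI) (simp add: flux_nonneg)
    finally show ?thesis by simp
  qed
  have "(\<integral>\<^sup>+p. ennreal (case p of (s, t) \<Rightarrow>
        indicator {- M..M} s * (indicator {- M..M} t * flux_decay s t)) \<partial>(lborel \<Otimes>\<^sub>M lborel))
      = (\<integral>\<^sup>+s. \<integral>\<^sup>+t. ennreal (indicator {- M..M} s * (indicator {- M..M} t * flux_decay s t)) \<partial>lborel \<partial>lborel)"
    by (subst lborel.nn_integral_fst[symmetric]) auto
  also have "\<dots> \<le> (\<integral>\<^sup>+s. 2 * indicator {- M..M} s \<partial>lborel)"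
    by (rule nn_integral_mono) (use inner in \<open>auto simp: indicator_def\<close>)
  also have "\<dots> < \<infinity>"
    using M by (simp add: nn_integral_cmult ennreal_mult_less_top)
  finally show "(\<integral>\<^sup>+p. ennreal (case p of (s, t) \<Rightarrow>
        indicator {- M..M} s * (indicator {- M..M} t * flux_decay s t)) \<partial>(lborel \<Otimes>\<^sub>M lborel)) < \<infinity>" .
qed measurable

lemma continuous_vanishing_bounded:
  fixes f :: "real \<times> real \<Rightarrow> real"
  assumes "continuous_on UNIV f" and "\<And>p. p \<notin> {- M..M} \<times> {- M..M} \<Longrightarrow> f p = 0"
  obtains B where "0 \<le> B" "\<And>p. \<bar>f p\<bar> \<le> B"
proof -
  have "compact (f ` ({- M..M} \<times> {- M..M}))"
    using assms(1) by (intro compact_continuous_image compact_Times continuous_on_subset[OF assms(1)]) auto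
  then have "bounded (f ` ({- M..M} \<times> {- M..M}))" by (rule compact_imp_bounded)
  then obtain B where "\<forall>u\<in>f ` ({- M..M} \<times> {- M..M}). norm u \<le> B"
    unfolding bounded_iff ..
  then have B: "\<bar>f p\<bar> \<le> B" if "p \<in> {- M..M} \<times> {- M..M}" for p
    using that by force
  show thesis
  proof (rule that[of "max 0 B"])
    fix p show "\<bar>f p\<bar> \<le> max 0 B"
      using B[of p] assms(2)[of p] by (cases "p \<in> {- M..M} \<times> {- M..M}") auto
  qed simp
qed

text \<open>Half of the weak equation: the \<open>t\<close>-derivative of \<open>sgn t * flux s t\<close> in the sense of distributions
  is \<open>- flux_decay s t\<close> plus twice the length measure on the axis \<open>t = 0\<close>. Only the partial derivative
  \<open>g\<close> of \<open>f\<close> in \<open>t\<close> enters, so that the lemma can also be applied to a reflected test function.\<close>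

lemma weak_derivative_sgn_flux:
  fixes f g :: "real \<times> real \<Rightarrow> real"
  assumes f: "continuous_on UNIV f" and g: "continuous_on UNIV g"
    and fg: "\<And>s t. DERIV (\<lambda>t. f (s, t)) t :> g (s, t)"
    and M: "0 \<le> M"
    and f0: "\<And>s t. M \<le> \<bar>s\<bar> \<or> M \<le> \<bar>t\<bar> \<Longrightarrow> f (s, t) = 0"
    and g0: "\<And>s t. M \<le> \<bar>s\<bar> \<or> M \<le> \<bar>t\<bar> \<Longrightarrow> g (s, t) = 0"
  defines "H \<equiv> \<lambda>(s, t). sgn t * flux s t * g (s, t) - flux_decay s t * f (s, t)"
  shows "integrable (lborel \<Otimes>\<^sub>M lborel) H"
    and "(\<integral>p. H p \<partial>(lborel \<Otimes>\<^sub>M lborel)) = - 2 * (\<integral>s. f (s, 0) \<partial>lborel)"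
proof -
  let ?K = "{- M..M}"
  have [measurable]: "f \<in> borel_measurable (borel \<Otimes>\<^sub>M borel)" "g \<in> borel_measurable (borel \<Otimes>\<^sub>M borel)"
    using f g by (simp_all add: borel_prod borel_measurable_continuous_onI)
  have outside: "f p = 0 \<and> g p = 0" if "p \<notin> ?K \<times> ?K" for p
  proof -
    have "M \<le> \<bar>fst p\<bar> \<or> M \<le> \<bar>snd p\<bar>" using that by (cases p) auto
    then show ?thesis using f0[of "fst p" "snd p"] g0[of "fst p" "snd p"] by simp
  qed
  obtain Bf where Bf: "0 \<le> Bf" "\<And>p. \<bar>f p\<bar> \<le> Bf"
    using continuous_vanishing_bounded[OF f, of M] outside by blast
  obtain Bg where Bg: "0 \<le> Bg" "\<And>p. \<bar>g p\<bar> \<le> Bg"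
    using continuous_vanishing_bounded[OF g, of M] outside by blast
  have "emeasure (lborel \<Otimes>\<^sub>M lborel) (?K \<times> ?K) < \<infinity>"
    using M by (simp add: lborel.emeasure_pair_measure_Times ennreal_mult_less_top)
  then have "integrable (lborel \<Otimes>\<^sub>M lborel) (\<lambda>p. indicator (?K \<times> ?K) p *\<^sub>R Bg)"
    by (intro integrableI_bounded_set_indicator[where B=Bg]) (use Bg in auto)
  then have 1: "integrable (lborel \<Otimes>\<^sub>M lborel) (\<lambda>(s, t). sgn t * flux s t * g (s, t))"
  proof (rule Bochner_Integration.integrable_bound)
    have "\<bar>sgn t * flux s t * g (s, t)\<bar> \<le> indicator (?K \<times> ?K) (s, t) * Bg" for s t
    proof (cases "(s, t) \<in> ?K \<times> ?K")
      case True
      have "\<bar>sgn t * flux s t\<bar> \<le> 1"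
        using flux_le_1[of s t] flux_nonneg[of s t] by (auto simp: abs_mult sgn_if)
      then have "\<bar>sgn t * flux s t\<bar> * \<bar>g (s, t)\<bar> \<le> 1 * Bg"
        using Bg by (intro mult_mono) auto
      then show ?thesis using True by (simp add: abs_mult)
    qed (use outside in auto)
    then show "AE p in lborel \<Otimes>\<^sub>M lborel. norm (case p of (s, t) \<Rightarrow> sgn t * flux s t * g (s, t))
        \<le> norm (indicator (?K \<times> ?K) p *\<^sub>R Bg)"
      using Bg by (auto simp: abs_mult)
  qed measurable
  from integrable_flux_decay_square[OF M]
  have "integrable (lborel \<Otimes>\<^sub>M lborel)
      (\<lambda>p. Bf * (case p of (s, t) \<Rightarrow> indicator ?K s * (indicator ?K t * flux_decay s t)))"
    by (rule integrable_mult_right)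
  then have 2: "integrable (lborel \<Otimes>\<^sub>M lborel) (\<lambda>(s, t). flux_decay s t * f (s, t))"
  proof (rule Bochner_Integration.integrable_bound)
    have "\<bar>flux_decay s t * f (s, t)\<bar> \<le> Bf * (indicator ?K s * (indicator ?K t * flux_decay s t))" for s t
    proof (cases "(s, t) \<in> ?K \<times> ?K")
      case True
      have "flux_decay s t * \<bar>f (s, t)\<bar> \<le> flux_decay s t * Bf"
        using Bf flux_decay_nonneg by (intro mult_left_mono) auto
      then show ?thesis using True flux_decay_nonneg[of s t] by (simp add: abs_mult mult.commute)
    qed (use outside[of "(s, t)"] Bf flux_decay_nonneg in auto)
    then show "AE p in lborel \<Otimes>\<^sub>M lborel. norm (case p of (s, t) \<Rightarrow> flux_decay s t * f (s, t))
        \<le> norm (Bf * (case p of (s, t) \<Rightarrow> indicator ?K s * (indicator ?K t * flux_decay s t)))"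
      using Bf flux_decay_nonneg by (auto simp: abs_mult)
  qed measurable
  show H: "integrable (lborel \<Otimes>\<^sub>M lborel) H"
    using Bochner_Integration.integrable_diff[OF 1 2] unfolding H_def by (simp add: case_prod_unfold)
  \<comment> \<open>The boundary terms at \<open>t = M\<close> and \<open>t = - M\<close> vanish, which leaves the jump at \<open>t = 0\<close>. The line
    \<open>s = 0\<close>, where the flux degenerates, is a null set of lines.\<close>
  have slice: "AE s in lborel. (\<integral>t. H (s, t) \<partial>lborel) = - 2 * f (s, 0)"
    using AE_lborel_singleton[of 0] lborel_pair.AE_integrable_fst'[OF H]
  proof eventually_elim
    case (elim s)
    have "((\<lambda>t. H (s, t)) has_integral - 2 * f (s, 0)) ?K"
      using has_integral_sgn_flux_by_parts[OF elim(1) M fg[of s]] f0[of s M] f0[of s "- M"] M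
      by (simp add: H_def)
    then have "((\<lambda>t. H (s, t)) has_integral - 2 * f (s, 0)) UNIV"
      by (rule has_integral_on_superset) (use outside in \<open>auto simp: H_def\<close>)
    then show ?case
      using has_integral_integral_lborel[OF elim(2)] has_integral_unique by blast
  qed
  have [measurable]: "H \<in> borel_measurable (lborel \<Otimes>\<^sub>M lborel)" using H by simp
  have "(\<integral>p. H p \<partial>(lborel \<Otimes>\<^sub>M lborel)) = (\<integral>s. \<integral>t. H (s, t) \<partial>lborel \<partial>lborel)"
    by (rule lborel_pair.integral_fst'[OF H, symmetric])
  also have "\<dots> = (\<integral>s. - 2 * f (s, 0) \<partial>lborel)"
    by (rule integral_cong_AE[OF _ _ slice]) measurable
  finally show "(\<integral>p. H p \<partial>(lborel \<Otimes>\<^sub>M lborel)) = - 2 * (\<integral>s. f (s, 0) \<partial>lborel)" by simp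
qed

section \<open>Test functions and the theorem\<close>

text \<open>What the proof needs from a test function: continuous partial derivatives and a box on whose
  boundary and outside of which everything vanishes.\<close>

lemma gradient_test_function:
  fixes \<phi> :: "real \<times> real \<Rightarrow> real"
  assumes "test_function \<phi>"
  obtains \<phi>x \<phi>y M where
    "continuous_on UNIV \<phi>" "continuous_on UNIV \<phi>x" "continuous_on UNIV \<phi>y"
    "\<And>p. GDERIV \<phi> p :> (\<phi>x p, \<phi>y p)"
    "0 \<le> (M::real)"
    "\<And>x y. M \<le> \<bar>x\<bar> \<or> M \<le> \<bar>y\<bar> \<Longrightarrow> \<phi> (x, y) = 0 \<and> \<phi>x (x, y) = 0 \<and> \<phi>y (x, y) = 0"
proof -
  let ?S = "closure {p. \<phi> p \<noteq> 0}"
  have C: "C_k k \<phi>" for k using assms by (simp add: test_function_def)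
  have S: "compact ?S" using assms by (simp add: test_function_def)
  define \<phi>x where "\<phi>x p = frechet_derivative \<phi> (at p) (1, 0)" for p
  define \<phi>y where "\<phi>y p = frechet_derivative \<phi> (at p) (0, 1)" for p
  have D: "(\<phi> has_derivative frechet_derivative \<phi> (at p)) (at p)" for p
    using C[of 1] by (simp add: frechet_derivative_works del: split_paired_All)
  have G: "GDERIV \<phi> p :> (\<phi>x p, \<phi>y p)" for p
  proof -
    interpret linear "frechet_derivative \<phi> (at p)"
      using D by (rule has_derivative_linear)
    have "frechet_derivative \<phi> (at p) (a, b) = inner (a, b) (\<phi>x p, \<phi>y p)" for a b
      using add[of "a *\<^sub>R (1, 0)" "b *\<^sub>R (0, 1)"] scaleR[of a "(1, 0)"] scaleR[of b "(0, 1)"]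
      by (simp add: \<phi>x_def \<phi>y_def)
    then have "frechet_derivative \<phi> (at p) = (\<lambda>h. inner h (\<phi>x p, \<phi>y p))" by auto
    then show ?thesis using D[of p] by (simp add: gderiv_def)
  qed
  obtain B where B: "\<And>p. p \<in> ?S \<Longrightarrow> norm p \<le> B"
    using compact_imp_bounded[OF S] by (auto simp: bounded_iff)
  have zero: "\<phi> p = 0 \<and> \<phi>x p = 0 \<and> \<phi>y p = 0" if "p \<notin> ?S" for p
  proof -
    have "((\<lambda>_. 0) has_derivative (\<lambda>h. inner h (\<phi>x p, \<phi>y p))) (at p)"
      using G[of p] unfolding gderiv_def
      by (rule has_derivative_transform_within_open[of _ _ _ _ "- ?S"])
         (use that closure_subset[of "{p. \<phi> p \<noteq> 0}"] in \<open>auto\<close>)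
    then have "(\<lambda>h. inner h (\<phi>x p, \<phi>y p)) = (\<lambda>h. 0)"
      by (rule has_derivative_unique) simp
    then have "inner (1, 0) (\<phi>x p, \<phi>y p) = 0" "inner (0, 1) (\<phi>x p, \<phi>y p) = 0" by metis+
    moreover have "\<phi> p = 0" using that closure_subset[of "{p. \<phi> p \<noteq> 0}"] by auto
    ultimately show ?thesis by simp
  qed
  show thesis
    \<comment> \<open>The margin 1 makes \<open>\<phi>\<close> vanish on the boundary of the box too.\<close>
  proof (rule that[of \<phi>x \<phi>y "\<bar>B\<bar> + 1"])
    show "continuous_on UNIV \<phi>" using C[of 0] by simp
    have "C_k 1 \<phi>" by (rule C)
    then show "continuous_on UNIV \<phi>x" "continuous_on UNIV \<phi>y"
      by (auto simp: \<phi>x_def[abs_def] \<phi>y_def[abs_def] Basis_prod_def)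
    fix x y :: real
    assume "\<bar>B\<bar> + 1 \<le> \<bar>x\<bar> \<or> \<bar>B\<bar> + 1 \<le> \<bar>y\<bar>"
    then have "B < norm (x, y)"
      using norm_fst_le[of x y] norm_snd_le[of y x] unfolding real_norm_def by linarith
    then show "\<phi> (x, y) = 0 \<and> \<phi>x (x, y) = 0 \<and> \<phi>y (x, y) = 0"
      using B[of "(x, y)"] by (intro zero) (simp add: not_le[symmetric], blast)
  qed (use G in auto)
qed

lemma DERIV_slices:
  assumes "GDERIV f (x, y) :> (a, b)"
  shows "DERIV (\<lambda>t. f (t, y)) x :> a" and "DERIV (\<lambda>t. f (x, t)) y :> b"
proof -
  have D: "(f has_derivative (\<lambda>h. inner h (a, b))) (at (x, y))"
    using assms by (simp add: gderiv_def)
  have "((\<lambda>t. (t, y)) has_derivative (\<lambda>h. (h, 0))) (at x)"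
    by (intro has_derivative_Pair has_derivative_ident has_derivative_const)
  from has_derivative_compose[OF this D]
  show "DERIV (\<lambda>t. f (t, y)) x :> a"
    by (simp add: has_field_derivative_def mult_commute_abs)
  have "((\<lambda>t. (x, t)) has_derivative (\<lambda>h. (0, h))) (at y)"
    by (intro has_derivative_Pair has_derivative_ident has_derivative_const)
  from has_derivative_compose[OF this D]
  show "DERIV (\<lambda>t. f (x, t)) y :> b"
    by (simp add: has_field_derivative_def mult_commute_abs)
qed

theorem lemma4p3:
  fixes w v :: "real \<times> real \<Rightarrow> real"
  assumes w: "\<And>x1 x2. w (x1, x2) = \<bar>x1\<bar> powr (4/3) - \<bar>x2\<bar> powr (4/3)"
    and v: "\<And>x. v x = 1/2 * (norm (gradient w x))\<^sup>2"
  shows "(\<forall>x. w differentiable (at x)) \<and>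
    (AE x in lebesgue. v differentiable (at x) \<and> gradient v x \<noteq> 0 \<and> v x \<noteq> 0) \<and>
    (\<forall>\<phi>. test_function \<phi> \<longrightarrow>
      integrable lebesgue (\<lambda>x. inner (gradient v x /\<^sub>R norm (gradient v x)) (gradient \<phi> x)
                              - norm (gradient v x) / (2 * v x) * \<phi> x) \<and>
      (\<integral>x. (inner (gradient v x /\<^sub>R norm (gradient v x)) (gradient \<phi> x)
             - norm (gradient v x) / (2 * v x) * \<phi> x) \<partial>lebesgue)
        = - 2 * (\<integral>x1. \<phi> (x1, 0) \<partial>lebesgue) - 2 * (\<integral>x2. \<phi> (0, x2) \<partial>lebesgue))"
proof -
  have Dw: "GDERIV w (x, y) :> (4/3 * sgn x * acbrt x, - (4/3 * sgn y * acbrt y))" for x y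
  proof -
    have "w = (\<lambda>p. \<bar>fst p\<bar> powr (4/3) + - (\<bar>snd p\<bar> powr (4/3)))" using w by auto
    then show ?thesis
      using GDERIV_separable_sum[OF DERIV_abs_powr_four_thirds
          DERIV_minus[OF DERIV_abs_powr_four_thirds], of x y] by simp
  qed
  have v_eq: "v (x, y) = 8/9 * (acbrt x)\<^sup>2 + 8/9 * (acbrt y)\<^sup>2" for x y
  proof -
    have sq: "(4/3 * sgn t * acbrt t)\<^sup>2 = 16/9 * (acbrt t)\<^sup>2" for t
      by (auto simp: sgn_if power_mult_distrib power_divide)
    have "(norm (gradient w (x, y)))\<^sup>2 = 16/9 * (acbrt x)\<^sup>2 + 16/9 * (acbrt y)\<^sup>2"
      unfolding gradient_eqI[OF Dw] norm_Pair real_norm_def power2_abs power2_minus sq by simp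
    then show ?thesis by (simp add: v)
  qed
  define N where "N = {p::real \<times> real. fst p = 0 \<or> snd p = 0}"
  have N: "negligible N"
  proof -
    have "N = {p. inner p (1, 0) = 0} \<union> {p. inner p (0, 1) = 0}"
      by (auto simp: N_def)
    then show ?thesis
      using negligible_standard_hyperplane[of "(1, 0) :: real \<times> real" 0]
        negligible_standard_hyperplane[of "(0, 1) :: real \<times> real" 0]
      by (auto simp: Basis_prod_def)
  qed
  have Dv: "GDERIV v (x, y) :> (16/27 * (sgn x / acbrt x), 16/27 * (sgn y / acbrt y))"
    if "x \<noteq> 0" "y \<noteq> 0" for x y
  proof -
    have D: "DERIV (\<lambda>t. 8/9 * (acbrt t)\<^sup>2) t :> 16/27 * (sgn t / acbrt t)" if "t \<noteq> 0" for t
      using that by (auto intro!: derivative_eq_intros DERIV_acbrt simp: field_simps power2_eq_square)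
    have "v = (\<lambda>p. 8/9 * (acbrt (fst p))\<^sup>2 + 8/9 * (acbrt (snd p))\<^sup>2)" using v_eq by auto
    then show ?thesis using GDERIV_separable_sum[OF D D] that by simp
  qed
  have grad_norm: "norm (gradient v (x, y)) =
      16/27 * (sqrt ((acbrt x)\<^sup>2 + (acbrt y)\<^sup>2) / (acbrt x * acbrt y))"
    if "x \<noteq> 0" "y \<noteq> 0" for x y
  proof -
    have "(norm (gradient v (x, y)))\<^sup>2 =
        (16/27 * (sqrt ((acbrt x)\<^sup>2 + (acbrt y)\<^sup>2) / (acbrt x * acbrt y)))\<^sup>2"
      unfolding gradient_eqI[OF Dv[OF that]] norm_Pair
      using that by (simp add: power_mult_distrib power_divide field_simps sgn_if)
    then show ?thesis by (rule power2_eq_imp_eq) auto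
  qed
  have direction: "gradient v (x, y) /\<^sub>R norm (gradient v (x, y)) = (sgn x * flux y x, sgn y * flux x y)"
    if "x \<noteq> 0" "y \<noteq> 0" for x y
  proof -
    define a b r where "a = acbrt x" and "b = acbrt y" and "r = sqrt (a\<^sup>2 + b\<^sup>2)"
    have "0 < a" "0 < b" using that by (simp_all add: a_def b_def)
    then have "0 < r" by (simp add: r_def sum_power2_gt_zero_iff)
    have n: "norm (gradient v (x, y)) = 16/27 * (r / (a * b))"
      using grad_norm[OF that] by (simp add: r_def a_def b_def)
    have g: "gradient v (x, y) = (16/27 * (sgn x / a), 16/27 * (sgn y / b))"
      using gradient_eqI[OF Dv[OF that]] by (simp add: a_def b_def)
    have fl: "flux x y = a / r" "flux y x = b / r"
      by (simp_all add: flux_def r_def a_def b_def add.commute)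
    show ?thesis
      unfolding n unfolding g fl using \<open>0 < a\<close> \<open>0 < b\<close> \<open>0 < r\<close> by (simp add: field_simps)
  qed
  have source: "norm (gradient v (x, y)) / (2 * v (x, y)) = flux_decay y x + flux_decay x y"
    if "x \<noteq> 0" "y \<noteq> 0" for x y
  proof -
    define a b r where "a = acbrt x" and "b = acbrt y" and "r = sqrt (a\<^sup>2 + b\<^sup>2)"
    have "0 < a" "0 < b" using that by (simp_all add: a_def b_def)
    then have "0 < r" and r2: "a\<^sup>2 + b\<^sup>2 = r\<^sup>2" by (simp_all add: r_def sum_power2_gt_zero_iff)
    have v_r: "v (x, y) = 8/9 * r\<^sup>2" by (simp add: v_eq r2[symmetric] a_def b_def)
    have n: "norm (gradient v (x, y)) = 16/27 * (r / (a * b))"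
      using grad_norm[OF that] by (simp add: r_def a_def b_def)
    have "flux_decay y x + flux_decay x y = b / (3 * a * r ^ 3) + a / (3 * b * r ^ 3)"
      by (simp add: flux_decay_def r_def a_def b_def add.commute)
    also have "\<dots> = (a\<^sup>2 + b\<^sup>2) / (3 * a * b * r ^ 3)"
      using \<open>0 < a\<close> \<open>0 < b\<close> \<open>0 < r\<close> by (simp add: field_simps power2_eq_square)
    also have "\<dots> = 1 / (3 * a * b * r)"
      unfolding r2 using \<open>0 < r\<close> by (simp add: power2_eq_square power3_eq_cube)
    also have "\<dots> = norm (gradient v (x, y)) / (2 * v (x, y))"
      unfolding n v_r using \<open>0 < a\<close> \<open>0 < b\<close> \<open>0 < r\<close> by (simp add: field_simps power2_eq_square)
    finally show ?thesis by simp
  qed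
  show ?thesis
  proof (intro conjI allI impI)
    show "w differentiable at p" for p
      using Dw[of "fst p" "snd p"] unfolding gderiv_def by (auto simp: differentiable_def)
    have "v differentiable at p \<and> gradient v p \<noteq> 0 \<and> v p \<noteq> 0" if pN: "p \<notin> N" for p
    proof -
      obtain x y where p: "p = (x, y)" "x \<noteq> 0" "y \<noteq> 0" using pN unfolding N_def by (cases p) simp
      have "v differentiable at p"
        using Dv[OF p(2,3)] unfolding gderiv_def p by (auto simp: differentiable_def)
      then show ?thesis using p by (simp add: gradient_eqI[OF Dv] v_eq zero_prod_def sgn_zero_iff add_nonneg_eq_0_iff)
    qed
    then have "{p. \<not> (v differentiable at p \<and> gradient v p \<noteq> 0 \<and> v p \<noteq> 0)} \<subseteq> N" by blast
    then show "AE p in lebesgue. v differentiable at p \<and> gradient v p \<noteq> 0 \<and> v p \<noteq> 0"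
      using N by (intro AE_I'[of N]) (auto simp: negligible_iff_null_sets)
  next
    fix \<phi> :: "real \<times> real \<Rightarrow> real"
    assume "test_function \<phi>"
    then obtain \<phi>x \<phi>y M where cont: "continuous_on UNIV \<phi>" "continuous_on UNIV \<phi>x" "continuous_on UNIV \<phi>y"
      and D\<phi>: "\<And>p. GDERIV \<phi> p :> (\<phi>x p, \<phi>y p)" and M: "0 \<le> (M::real)"
      and zero: "\<And>x y. M \<le> \<bar>x\<bar> \<or> M \<le> \<bar>y\<bar> \<Longrightarrow> \<phi> (x, y) = 0 \<and> \<phi>x (x, y) = 0 \<and> \<phi>y (x, y) = 0"
      by (rule gradient_test_function) blast
    let ?L = "lborel \<Otimes>\<^sub>M lborel :: (real \<times> real) measure"
    define F where "F p = inner (gradient v p /\<^sub>R norm (gradient v p)) (gradient \<phi> p)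
        - norm (gradient v p) / (2 * v p) * \<phi> p" for p
    define X where "X = (\<lambda>(y, x). sgn x * flux y x * \<phi>x (x, y) - flux_decay y x * \<phi> (x, y))"
    define Y where "Y = (\<lambda>(x, y). sgn y * flux x y * \<phi>y (x, y) - flux_decay x y * \<phi> (x, y))"
    have Y: "integrable ?L Y" "(\<integral>p. Y p \<partial>?L) = - 2 * (\<integral>x. \<phi> (x, 0) \<partial>lborel)"
      unfolding Y_def
      by (rule weak_derivative_sgn_flux[where M=M]; use cont D\<phi> M zero DERIV_slices(2) in blast)+
    have contswap: "continuous_on UNIV (\<lambda>p. f (prod.swap p))" if "continuous_on UNIV f"
      for f :: "real \<times> real \<Rightarrow> real"
      by (rule continuous_on_compose2[OF that]) (auto intro: continuous_intros)
    have swapped: "DERIV (\<lambda>t. \<phi> (prod.swap (s, t))) t :> \<phi>x (prod.swap (s, t))"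
        "M \<le> \<bar>s\<bar> \<or> M \<le> \<bar>t\<bar> \<Longrightarrow> \<phi> (prod.swap (s, t)) = 0"
        "M \<le> \<bar>s\<bar> \<or> M \<le> \<bar>t\<bar> \<Longrightarrow> \<phi>x (prod.swap (s, t)) = 0" for s t
      using DERIV_slices(1)[OF D\<phi>] zero[of t s] by auto
    \<comment> \<open>The jump of the first component sits on the axis \<open>x = 0\<close>, so \<open>x\<close> has to be the inner variable:
      the lemma is applied with the coordinates exchanged, and the result is reflected back.\<close>
    have X: "integrable ?L X" "(\<integral>p. X p \<partial>?L) = - 2 * (\<integral>y. \<phi> (0, y) \<partial>lborel)"
      using weak_derivative_sgn_flux[OF contswap[OF cont(1)] contswap[OF cont(2)] swapped(1) M swapped(2,3)]
      unfolding X_def by simp_all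
    define X' where "X' = (\<lambda>(x, y). X (y, x))"
    have X': "integrable ?L X'" "(\<integral>p. X' p \<partial>?L) = - 2 * (\<integral>y. \<phi> (0, y) \<partial>lborel)"
      using lborel_pair.integrable_product_swap[OF X(1)]
        lborel_pair.integral_product_swap[of X] X by (auto simp: X'_def)
    define E where "E p = X' p + Y p" for p
    have E: "integrable lborel E"
      "(\<integral>p. E p \<partial>lborel) = - 2 * (\<integral>y. \<phi> (0, y) \<partial>lborel) - 2 * (\<integral>x. \<phi> (x, 0) \<partial>lborel)"
      using X' Y by (simp_all add: E_def[abs_def] lborel_prod[symmetric])
    \<comment> \<open>On the axes \<open>F\<close> contains gradients with unspecified values; the passage from \<open>E\<close> to \<open>F\<close> works
      because the axes are negligible and Lebesgue measure is complete.\<close>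
    have FE: "F p = E p" if pN: "p \<notin> N" for p
    proof -
      obtain x y where p: "p = (x, y)" "x \<noteq> 0" "y \<noteq> 0" using pN unfolding N_def by (cases p) simp
      show ?thesis
        unfolding F_def E_def X'_def X_def Y_def p(1) direction[OF p(2,3)] source[OF p(2,3)]
          gradient_eqI[OF D\<phi>] by (simp add: algebra_simps)
    qed
    have Emeas: "E \<in> borel_measurable lborel" using E by simp
    have intE: "integrable lebesgue E" using E(1) Emeas by (simp add: integrable_completion)
    then have "E absolutely_integrable_on UNIV" by (simp add: set_integrable_def)
    then have "F absolutely_integrable_on UNIV"
      by (rule absolutely_integrable_spike[OF _ N]) (use FE in auto)
    then have intF: "integrable lebesgue F" by (simp add: set_integrable_def)
    have "AE p in lebesgue. F p = E p"
      using N FE by (intro AE_I'[of N]) (auto simp: negligible_iff_null_sets)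
    then have "(\<integral>p. F p \<partial>lebesgue) = (\<integral>p. E p \<partial>lebesgue)"
      using intF intE by (intro integral_cong_AE) auto
    also have "\<dots> = (\<integral>p. E p \<partial>lborel)" using Emeas by (rule integral_completion)
    also have "\<dots> = - 2 * (\<integral>x. \<phi> (x, 0) \<partial>lebesgue) - 2 * (\<integral>y. \<phi> (0, y) \<partial>lebesgue)"
    proof -
      have "(\<lambda>x. \<phi> (x, 0)) \<in> borel_measurable lborel" "(\<lambda>y. \<phi> (0, y)) \<in> borel_measurable lborel"
        by (auto intro!: borel_measurable_continuous_onI continuous_on_compose2[OF cont(1)] continuous_intros)
      then show ?thesis by (simp add: E(2) integral_completion)
    qed
    finally have intFeq: "(\<integral>p. F p \<partial>lebesgue)
        = - 2 * (\<integral>x. \<phi> (x, 0) \<partial>lebesgue) - 2 * (\<integral>y. \<phi> (0, y) \<partial>lebesgue)" .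
    show "integrable lebesgue (\<lambda>p. inner (gradient v p /\<^sub>R norm (gradient v p)) (gradient \<phi> p)
        - norm (gradient v p) / (2 * v p) * \<phi> p)"
      using intF unfolding F_def .
    show "(\<integral>p. (inner (gradient v p /\<^sub>R norm (gradient v p)) (gradient \<phi> p)
        - norm (gradient v p) / (2 * v p) * \<phi> p) \<partial>lebesgue)
        = - 2 * (\<integral>x. \<phi> (x, 0) \<partial>lebesgue) - 2 * (\<integral>y. \<phi> (0, y) \<partial>lebesgue)"
      using intFeq unfolding F_def .
  qed
qed

end
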